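(* If $p$ is a non-zero integer and $n$ is a positive integer, then $$\sum_{k=0}^n\Bigl(\frac{16}{5}\Bigr)^k\frac{n}{n+k}\binom{n+k}{n-k}F_{2p}^{2(n-k)}=\frac{25^nF_p^{4n}+L_p^{4n}}{2\cdot5^n},$$ $$\sum_{k=0}^n(-1)^{n-k}\Bigl(\frac45\Bigr)^k\frac{n}{n+k}\binom{n+k}{n-k}\Bigl(\frac{F_{2p}}{L_{2p}}\Bigr)^{2(n-k)}=\frac{25^nF_p^{4n}+L_p^{4n}}{2\cdot5^nL_{2p}^{2n}}.$$ In particular, $$\sum_{k=0}^n\Bigl(\frac{16}{5}\Bigr)^k\frac{n}{n+k}\binom{n+k}{n-k}=\frac{25^n+1}{2\cdot5^n},\qquad \sum_{k=0}^n(-1)^{n-k}\Bigl(\frac{36}{5}\Bigr)^k\frac{n}{n+k}\binom{n+k}{n-k}=\frac{25^n+1}{2\cdot5^n}.$$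
   Context: $F_n$ and $L_n$ ($n\in\mathbb{Z}$) are the Fibonacci and Lucas numbers: $F_0=0$, $F_1=1$, $F_n=F_{n-1}+F_{n-2}$; $L_0=2$, $L_1=1$, $L_n=L_{n-1}+L_{n-2}$, extended to negative indices by $F_{-n}=(-1)^{n-1}F_n$, $L_{-n}=(-1)^nL_n$. *)

theory Defs
  imports Complex_Main "HOL-Number_Theory.Fib"
begin

text \<open>
  The library function \<open>fib\<close> covers the indices \<open>n \<ge> 0\<close>. Both sequences are extended to
  negative indices by the rules \<open>F(-m) = (-1)^(m-1) F(m)\<close> and \<open>L(-m) = (-1)^m L(m)\<close> for \<open>m > 0\<close>.
\<close>

definition fib_int :: "int \<Rightarrow> int" where
  "fib_int n = (if n \<ge> 0 then int (fib (nat n))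
                else (-1) ^ (nat (-n) - 1) * int (fib (nat (-n))))"

fun lucas :: "nat \<Rightarrow> nat" where
  "lucas 0 = 2"
| "lucas (Suc 0) = 1"
| "lucas (Suc (Suc n)) = lucas (Suc n) + lucas n"

definition lucas_int :: "int \<Rightarrow> int" where
  "lucas_int n = (if n \<ge> 0 then int (lucas (nat n))
                  else (-1) ^ nat (-n) * int (lucas (nat (-n))))"

end

theory Submission
  imports Defs
begin

text \<open>
  All four sums are values of
  \<open>S\<^sub>n(y, z) = (\<Sum>k\<le>n. n/(n+k) * (n+k choose n-k) * y^k * z^(n-k))\<close>, and
  \<open>2 S\<^sub>n(y, z) = a^n + b^n\<close> whenever \<open>a + b = y + 2z\<close> and \<open>a b = z\<^sup>2\<close>. To see this, split
  \<open>2n/(n+k) * (n+k choose 2k) = (n+k choose 2k) + (n+k-1 choose 2k)\<close>; the two resulting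
  Morgan-Voyce polynomials satisfy the second order recurrence with characteristic roots \<open>a, b\<close>.
  The Fibonacci sums are the cases \<open>a = 5 F\<^sub>p^4, b = L\<^sub>p^4 / 5\<close>, up to the factor \<open>1 / L\<^sub>2\<^sub>p\<^sup>2\<close>;
  the hypotheses follow from \<open>F\<^sub>2\<^sub>p = F\<^sub>p L\<^sub>p\<close>, \<open>2 L\<^sub>2\<^sub>p = L\<^sub>p\<^sup>2 + 5 F\<^sub>p\<^sup>2\<close> and
  \<open>(L\<^sub>p\<^sup>2 - 5 F\<^sub>p\<^sup>2)\<^sup>2 = 16\<close>.
\<close>

text \<open>Homogenised Morgan-Voyce polynomials: at \<open>z = 1\<close> this is b_n(y), and
  \<open>mv_odd\<close> is B_{n-1}(y).\<close>

definition mv_even :: "'a::comm_ring_1 \<Rightarrow> 'a \<Rightarrow> nat \<Rightarrow> 'a" where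
  "mv_even y z n = (\<Sum>k\<le>n. of_nat ((n + k) choose (2 * k)) * y ^ k * z ^ (n - k))"

definition mv_odd :: "'a::comm_ring_1 \<Rightarrow> 'a \<Rightarrow> nat \<Rightarrow> 'a" where
  "mv_odd y z n = (\<Sum>k\<le>n. of_nat ((n + k) choose (2 * k + 1)) * y ^ k * z ^ (n - k))"

text \<open>Pascal's rule, once the top summand has been dropped: its binomial is (2n+2 choose 2n+3)
  = 0.\<close>

lemma mv_odd_Suc: "mv_odd y z (Suc n) = z * (mv_even y z n + mv_odd y z n)"
proof -
  have "mv_odd y z (Suc n) =
      (\<Sum>k\<le>n. of_nat ((Suc n + k) choose (2 * k + 1)) * y ^ k * z ^ (Suc n - k))"
    unfolding mv_odd_def by (simp add: binomial_eq_0)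
  also have "\<dots> = (\<Sum>k\<le>n. z * (of_nat ((n + k) choose (2 * k)) * y ^ k * z ^ (n - k)
      + of_nat ((n + k) choose (2 * k + 1)) * y ^ k * z ^ (n - k)))"
    by (intro sum.cong) (auto simp: Suc_diff_le algebra_simps)
  finally show ?thesis
    by (simp add: mv_even_def mv_odd_def sum.distrib flip: sum_distrib_left)
qed

text \<open>Pascal's rule applied twice to (n+k+2 choose 2k+2). The shift isolates the summand
  \<open>z ^ Suc n\<close>, which later rejoins the (n+k+1 choose 2k+2) part to form
  \<open>z * mv_even y z n\<close>.\<close>

lemma mv_even_Suc: "mv_even y z (Suc n) = z * mv_even y z n + y * (mv_even y z n + mv_odd y z n)"
proof -
  have "mv_even y z (Suc n) = z ^ Suc n +
      (\<Sum>k\<le>n. of_nat ((Suc n + Suc k) choose (2 * Suc k)) * y ^ Suc k * z ^ (n - k))"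
    unfolding mv_even_def by (subst sum.atMost_Suc_shift) simp
  also have "(\<Sum>k\<le>n. of_nat ((Suc n + Suc k) choose (2 * Suc k)) * y ^ Suc k * z ^ (n - k)) =
      (\<Sum>k\<le>n. of_nat ((n + Suc k) choose (2 * Suc k)) * y ^ Suc k * z ^ (n - k)
        + y * (of_nat ((n + k) choose (2 * k)) * y ^ k * z ^ (n - k)
        + of_nat ((n + k) choose (2 * k + 1)) * y ^ k * z ^ (n - k)))"
    by (intro sum.cong) (auto simp: algebra_simps)
  also have "\<dots> = (\<Sum>k\<le>n. of_nat ((n + Suc k) choose (2 * Suc k)) * y ^ Suc k * z ^ (n - k))
        + y * (mv_even y z n + mv_odd y z n)"
    by (simp add: mv_even_def mv_odd_def sum.distrib flip: sum_distrib_left)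
  also have "z ^ Suc n + \<dots> =
      (\<Sum>k\<le>Suc n. of_nat ((n + k) choose (2 * k)) * y ^ k * z ^ (Suc n - k))
        + y * (mv_even y z n + mv_odd y z n)"
    by (subst sum.atMost_Suc_shift) simp
  also have "(\<Sum>k\<le>Suc n. of_nat ((n + k) choose (2 * k)) * y ^ k * z ^ (Suc n - k)) =
      z * mv_even y z n"
    by (simp add: mv_even_def binomial_eq_0 sum_distrib_left Suc_diff_le algebra_simps)
  finally show ?thesis .
qed

lemma mv_even_add_eq_power_sum:
  fixes a b y z :: "'a::comm_ring_1"
  assumes sum: "a + b = y + 2 * z" and prod: "a * b = z\<^sup>2"
  shows "mv_even y z (Suc n) + z * mv_even y z n = a ^ Suc n + b ^ Suc n"
\<comment> \<open>\<open>fib.induct\<close> serves only as two-step induction: both sides satisfy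
  u_{n+2} = (a+b) u_{n+1} - ab u_n.\<close>
proof (induction n rule: fib.induct)
  case 1
  show ?case using sum by (simp add: mv_even_Suc) (simp add: mv_even_def mv_odd_def algebra_simps)
next
  case 2
  have "a ^ 2 + b ^ 2 = (y + 2 * z)\<^sup>2 - 2 * z\<^sup>2"
    unfolding sum[symmetric] prod[symmetric] by (simp add: power2_eq_square algebra_simps)
  then show ?case
    by (simp add: mv_even_Suc mv_odd_Suc power2_eq_square)
      (simp add: mv_even_def mv_odd_def algebra_simps)
next
  case (3 n)
  have rec: "mv_even y z (Suc (Suc m)) = (y + 2 * z) * mv_even y z (Suc m) - z\<^sup>2 * mv_even y z m"
    for m
    by (simp add: mv_even_Suc mv_odd_Suc power2_eq_square algebra_simps)
  have "mv_even y z (Suc (Suc (Suc n))) + z * mv_even y z (Suc (Suc n)) =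
      (y + 2 * z) * (mv_even y z (Suc (Suc n)) + z * mv_even y z (Suc n))
      - z\<^sup>2 * (mv_even y z (Suc n) + z * mv_even y z n)"
    unfolding rec[of n] rec[of "Suc n"] by (simp add: algebra_simps)
  also have "\<dots> = (a + b) * (a ^ Suc (Suc n) + b ^ Suc (Suc n))
      - a * b * (a ^ Suc n + b ^ Suc n)"
    using 3 by (simp add: sum prod)
  also have "\<dots> = a ^ Suc (Suc (Suc n)) + b ^ Suc (Suc (Suc n))"
    by (simp add: algebra_simps)
  finally show ?case .
qed

text \<open>With n = \<open>Suc m\<close>, write 2n = (n+k) + (n-k) and use absorption, (n-k) (n+k
  choose 2k) = (n+k) (n+k-1 choose 2k).\<close>

lemma double_ratio_times_binomial:
  assumes "k \<le> Suc m"
  shows "2 * (real (Suc m) / real (Suc m + k) * real ((Suc m + k) choose (Suc m - k)))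
    = real ((Suc m + k) choose (2 * k)) + real ((m + k) choose (2 * k))"
proof -
  have sym: "(Suc m + k) choose (Suc m - k) = (Suc m + k) choose (2 * k)"
    using assms binomial_symmetric[of "2 * k" "Suc m + k"] by (simp add: mult_2)
  have "(Suc (m + k) - 2 * k) * (Suc (m + k) choose (2 * k)) = Suc (m + k) * ((m + k) choose (2 * k))"
    using binomial_absorb_comp[of "Suc (m + k)" "2 * k"] by simp
  then have "real (Suc (m + k) - 2 * k) * real (Suc (m + k) choose (2 * k))
      = real (Suc (m + k)) * real ((m + k) choose (2 * k))"
    by (metis of_nat_mult)
  moreover have "real (Suc (m + k) - 2 * k) = real (Suc m) - real k"
    using assms by (simp add: of_nat_diff)
  ultimately show ?thesis
    unfolding sym by (simp add: field_simps)
qed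

lemma ratio_binomial_sum_eq_power_sum:
  fixes a b y z :: real
  assumes "n > 0" and sum: "a + b = y + 2 * z" and prod: "a * b = z\<^sup>2"
  shows "(\<Sum>k=0..n. y ^ k * (real n / real (n + k)) * real ((n + k) choose (n - k)) * z ^ (n - k))
    = (a ^ n + b ^ n) / 2"
proof -
  obtain m where n: "n = Suc m"
    using \<open>n > 0\<close> gr0_implies_Suc by blast
  have "2 * (\<Sum>k\<le>n. y ^ k * (real n / real (n + k)) * real ((n + k) choose (n - k)) * z ^ (n - k))
      = (\<Sum>k\<le>n. (2 * (real n / real (n + k) * real ((n + k) choose (n - k)))) * (y ^ k * z ^ (n - k)))"
    by (simp add: sum_distrib_left mult_ac)
  also have "\<dots> = (\<Sum>k\<le>Suc m. real ((Suc m + k) choose (2 * k)) * y ^ k * z ^ (Suc m - k)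
      + real ((m + k) choose (2 * k)) * y ^ k * z ^ (Suc m - k))"
    unfolding n
    by (intro sum.cong refl, subst double_ratio_times_binomial) (auto simp: algebra_simps)
  \<comment> \<open>In the second sum the summand k = \<open>Suc m\<close> vanishes, and every other
    one has a spare factor \<open>z\<close>.\<close>
  also have "\<dots> = mv_even y z (Suc m) + z * mv_even y z m"
    unfolding sum.distrib mv_even_def[of y z "Suc m"]
    by (simp add: mv_even_def binomial_eq_0 sum_distrib_left Suc_diff_le algebra_simps)
  also have "\<dots> = a ^ n + b ^ n"
    using mv_even_add_eq_power_sum[OF sum prod] n by simp
  finally show ?thesis
    by (simp add: atMost_atLeast0)
qed

lemma lucas_eq_fib: "int (lucas n) = 2 * int (fib (Suc n)) - int (fib n)"
  by (induction n rule: lucas.induct) auto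

text \<open>Cassini's identity with F_{n-1} replaced by F_{n+1} - F_n, which avoids a predecessor
  index.\<close>

lemma fib_cassini: "(int (fib (Suc n)))\<^sup>2 - int (fib (Suc n)) * int (fib n) - (int (fib n))\<^sup>2 = (-1) ^ n"
proof (induction n)
  case (Suc n)
  then show ?case by (simp add: power2_eq_square algebra_simps)
qed simp

lemma lucas_sq_minus_fib_sq: "(int (lucas n))\<^sup>2 - 5 * (int (fib n))\<^sup>2 = 4 * (-1) ^ n"
  unfolding lucas_eq_fib fib_cassini[symmetric] by (simp add: power2_eq_square algebra_simps)

lemma fib_lucas_double:
  shows "int (fib (2 * n)) = int (fib n) * int (lucas n)"
    and "2 * int (lucas (2 * n)) = (int (lucas n))\<^sup>2 + 5 * (int (fib n))\<^sup>2"
proof -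
  \<comment> \<open>The odd-index formula is carried along because the induction needs two
    consecutive values.\<close>
  have "int (fib (2 * n)) = int (fib n) * int (lucas n) \<and>
      int (fib (Suc (2 * n))) = (int (fib (Suc n)))\<^sup>2 + (int (fib n))\<^sup>2"
    by (induction n) (auto simp: lucas_eq_fib power2_eq_square algebra_simps)
  then show "int (fib (2 * n)) = int (fib n) * int (lucas n)"
    and "2 * int (lucas (2 * n)) = (int (lucas n))\<^sup>2 + 5 * (int (fib n))\<^sup>2"
    by (auto simp: lucas_eq_fib power2_eq_square algebra_simps)
qed

text \<open>Squaring removes the sign at negative indices. Only even powers occur below, so the
  natural-number identities suffice.\<close>

lemma fib_int_sq: "(fib_int p)\<^sup>2 = (int (fib (nat \<bar>p\<bar>)))\<^sup>2"
  by (simp add: fib_int_def power_mult_distrib flip: power_mult)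

lemma lucas_int_sq: "(lucas_int p)\<^sup>2 = (int (lucas (nat \<bar>p\<bar>)))\<^sup>2"
  by (simp add: lucas_int_def power_mult_distrib flip: power_mult)

lemma nat_abs_double: "nat \<bar>2 * p\<bar> = 2 * nat \<bar>p\<bar>"
  by simp

lemma fib_int_double_sq: "(fib_int (2 * p))\<^sup>2 = (fib_int p)\<^sup>2 * (lucas_int p)\<^sup>2"
  unfolding fib_int_sq lucas_int_sq nat_abs_double fib_lucas_double by (simp add: power_mult_distrib)

lemma lucas_int_double_sq:
  "4 * (lucas_int (2 * p))\<^sup>2 = ((lucas_int p)\<^sup>2 + 5 * (fib_int p)\<^sup>2)\<^sup>2"
  unfolding fib_int_sq lucas_int_sq nat_abs_double fib_lucas_double(2)[symmetric]
  by (simp add: power_mult_distrib)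

text \<open>The outer square removes the parity-dependent sign of 4 (-1)^p.\<close>

lemma lucas_int_sq_minus_fib_int_sq: "((lucas_int p)\<^sup>2 - 5 * (fib_int p)\<^sup>2)\<^sup>2 = 16"
  unfolding fib_int_sq lucas_int_sq lucas_sq_minus_fib_sq
  by (simp add: power_mult_distrib flip: power_mult)

lemma fib_int_sum:
  assumes "n > 0"
  shows "(\<Sum>k=0..n. (16/5) ^ k * (real n / real (n + k)) * real ((n + k) choose (n - k))
        * real_of_int (fib_int (2 * p)) ^ (2 * (n - k)))
    = (25 ^ n * real_of_int (fib_int p) ^ (4 * n) + real_of_int (lucas_int p) ^ (4 * n)) / (2 * 5 ^ n)"
proof -
  define F where "F = real_of_int (fib_int p)"
  define L where "L = real_of_int (lucas_int p)"
  define G where "G = real_of_int (fib_int (2 * p))"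
  have G: "G\<^sup>2 = F\<^sup>2 * L\<^sup>2"
    using arg_cong[OF fib_int_double_sq[of p], of real_of_int] by (simp add: F_def L_def G_def)
  have FL: "(L\<^sup>2 - 5 * F\<^sup>2)\<^sup>2 = 16"
    using arg_cong[OF lucas_int_sq_minus_fib_int_sq[of p], of real_of_int]
    by (simp add: F_def L_def)
  \<comment> \<open>Reading 16 as the square in \<open>FL\<close>, the term
    \<open>2 * G\<^sup>2\<close> cancels its cross term after division by 5.\<close>
  have "5 * F ^ 4 + L ^ 4 / 5 = 16/5 + 2 * G\<^sup>2"
    unfolding FL[symmetric] G by (simp add: field_simps power2_eq_square power4_eq_xxxx)
  moreover have "(5 * F ^ 4) * (L ^ 4 / 5) = (G\<^sup>2)\<^sup>2"
    unfolding G by (simp add: power_mult_distrib)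
  ultimately have "(\<Sum>k=0..n. (16/5) ^ k * (real n / real (n + k)) * real ((n + k) choose (n - k))
      * (G\<^sup>2) ^ (n - k)) = ((5 * F ^ 4) ^ n + (L ^ 4 / 5) ^ n) / 2"
    by (rule ratio_binomial_sum_eq_power_sum[OF assms])
  also have "\<dots> = (25 ^ n * F ^ (4 * n) + L ^ (4 * n)) / (2 * 5 ^ n)"
    \<comment> \<open>Supplies \<open>25 ^ n = 5 ^ n * 5 ^ n\<close> for the common
      denominator.\<close>
    using power_mult_distrib[of "5::real" 5 n]
    unfolding power_mult[of _ 4] by (simp add: field_simps power_divide)
  finally show ?thesis
    by (simp only: F_def L_def G_def power_mult)
qed

lemma fib_int_lucas_int_ratio_sum:
  assumes "n > 0"
  shows "(\<Sum>k=0..n. (-1) ^ (n - k) * (4/5) ^ k * (real n / real (n + k))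
        * real ((n + k) choose (n - k))
        * (real_of_int (fib_int (2 * p)) / real_of_int (lucas_int (2 * p))) ^ (2 * (n - k)))
    = (25 ^ n * real_of_int (fib_int p) ^ (4 * n) + real_of_int (lucas_int p) ^ (4 * n))
        / (2 * 5 ^ n * real_of_int (lucas_int (2 * p)) ^ (2 * n))"
proof -
  define F where "F = real_of_int (fib_int p)"
  define L where "L = real_of_int (lucas_int p)"
  define G where "G = real_of_int (fib_int (2 * p))"
  define M where "M = real_of_int (lucas_int (2 * p))"
  have G: "G\<^sup>2 = F\<^sup>2 * L\<^sup>2"
    using arg_cong[OF fib_int_double_sq[of p], of real_of_int] by (simp add: F_def L_def G_def)
  have M: "4 * M\<^sup>2 = (L\<^sup>2 + 5 * F\<^sup>2)\<^sup>2"
    using arg_cong[OF lucas_int_double_sq[of p], of real_of_int] by (simp add: F_def L_def M_def)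
  have FL: "(L\<^sup>2 - 5 * F\<^sup>2)\<^sup>2 = 16"
    using arg_cong[OF lucas_int_sq_minus_fib_int_sq[of p], of real_of_int]
    by (simp add: F_def L_def)
  have "M \<noteq> 0"
  proof
    assume "M = 0"
    then have "L\<^sup>2 + 5 * F\<^sup>2 = 0" using M by simp
    then have "F\<^sup>2 = 0" "L\<^sup>2 = 0" using zero_le_power2[of F] zero_le_power2[of L] by linarith+
    then show False using FL by simp
  qed
  \<comment> \<open>The minus sign absorbs the alternating factor \<open>(-1) ^ (n - k)\<close>; the
    roots are those of the first sum divided by \<open>M\<^sup>2\<close>.\<close>
  define z where "z = - ((G / M)\<^sup>2)"
  have "25 * F ^ 4 + L ^ 4 = 4 * M\<^sup>2 - 10 * G\<^sup>2"
    unfolding M G by (simp add: algebra_simps power2_eq_square power4_eq_xxxx)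
  then have "5 * F ^ 4 / M\<^sup>2 + L ^ 4 / (5 * M\<^sup>2) = 4/5 + 2 * z"
    using \<open>M \<noteq> 0\<close> by (simp add: z_def field_simps power_divide)
  moreover have "(5 * F ^ 4 / M\<^sup>2) * (L ^ 4 / (5 * M\<^sup>2)) = z\<^sup>2"
    unfolding z_def power_divide G by (simp add: power_divide power_mult_distrib)
  ultimately have "(\<Sum>k=0..n. (4/5) ^ k * (real n / real (n + k)) * real ((n + k) choose (n - k))
      * z ^ (n - k)) = ((5 * F ^ 4 / M\<^sup>2) ^ n + (L ^ 4 / (5 * M\<^sup>2)) ^ n) / 2"
    by (rule ratio_binomial_sum_eq_power_sum[OF assms])
  also have "\<dots> = (25 ^ n * F ^ (4 * n) + L ^ (4 * n)) / (2 * 5 ^ n * M ^ (2 * n))"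
    using power_mult_distrib[of "5::real" 5 n] \<open>M \<noteq> 0\<close>
    unfolding power_mult[of _ 4] power_mult[of _ 2]
    by (simp add: field_simps power_divide power_mult_distrib)
  also have "(\<Sum>k=0..n. (4/5) ^ k * (real n / real (n + k)) * real ((n + k) choose (n - k))
      * z ^ (n - k)) = (\<Sum>k=0..n. (-1) ^ (n - k) * (4/5) ^ k * (real n / real (n + k))
        * real ((n + k) choose (n - k)) * (G / M) ^ (2 * (n - k)))"
    unfolding z_def power_mult power_minus[of "(G / M)\<^sup>2"]
    by (intro sum.cong refl) (simp only: mult_ac)
  finally show ?thesis
    by (simp only: F_def L_def G_def M_def)
qed

theorem theorem5:
  fixes n :: nat
  assumes "n > 0"
  shows "(\<forall>p::int. p \<noteq> 0 \<longrightarrow>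
            (\<Sum>k=0..n. (16/5) ^ k * (real n / real (n + k)) * real ((n + k) choose (n - k))
                * real_of_int (fib_int (2 * p)) ^ (2 * (n - k)))
              = (25 ^ n * real_of_int (fib_int p) ^ (4 * n) + real_of_int (lucas_int p) ^ (4 * n))
                  / (2 * 5 ^ n)
          \<and> (\<Sum>k=0..n. (-1) ^ (n - k) * (4/5) ^ k * (real n / real (n + k))
                * real ((n + k) choose (n - k))
                * (real_of_int (fib_int (2 * p)) / real_of_int (lucas_int (2 * p))) ^ (2 * (n - k)))
              = (25 ^ n * real_of_int (fib_int p) ^ (4 * n) + real_of_int (lucas_int p) ^ (4 * n))
                  / (2 * 5 ^ n * real_of_int (lucas_int (2 * p)) ^ (2 * n)))
       \<and> (\<Sum>k=0..n. (16/5) ^ k * (real n / real (n + k)) * real ((n + k) choose (n - k)))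
            = (25 ^ n + 1) / (2 * 5 ^ n)
       \<and> (\<Sum>k=0..n. (-1) ^ (n - k) * (36/5) ^ k * (real n / real (n + k))
                * real ((n + k) choose (n - k)))
            = (25 ^ n + 1) / (2 * 5 ^ n)"
proof (intro conjI allI impI)
  have pow: "(5 ^ n + (1/5) ^ n) / 2 = ((25 ^ n + 1) / (2 * 5 ^ n) :: real)"
    using power_mult_distrib[of "5::real" 5 n] by (simp add: field_simps)
  show "(\<Sum>k=0..n. (16/5) ^ k * (real n / real (n + k)) * real ((n + k) choose (n - k)))
      = (25 ^ n + 1) / (2 * 5 ^ n)"
    \<comment> \<open>The case p = 1, where F_1 = L_1 = F_2 = 1, so the roots are 5 and 1/5.\<close>
    using ratio_binomial_sum_eq_power_sum[OF assms, of 5 "1/5" "16/5" 1] by (simp add: pow)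
  show "(\<Sum>k=0..n. (-1) ^ (n - k) * (36/5) ^ k * (real n / real (n + k))
        * real ((n + k) choose (n - k))) = (25 ^ n + 1) / (2 * 5 ^ n)"
    \<comment> \<open>Again p = 1, with the second identity multiplied by L_2^(2n) = 9^n: this turns
      4/5 into 36/5 and restores the roots 5 and 1/5.\<close>
    using ratio_binomial_sum_eq_power_sum[OF assms, of 5 "1/5" "36/5" "-1"]
    by (simp add: pow mult_ac)
qed (rule fib_int_sum[OF assms] fib_int_lucas_int_ratio_sum[OF assms])+

end
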